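(* For every integer $n\geq 2$ and every permutation $\mathbf{a}$ of $[n]=\{1,\dots,n\}$, $\mathbf{a}$ contains a pair of twins of length at least $\tfrac{1}{8}n^{3/5}$.
   Context: A permutation of a finite set $\Sigma\subset\mathbb{N}$ is a sequence in which every element of $\Sigma$ appears exactly once; a subpermutation of a permutation is a subsequence of it. Two sequences $(a_1,\dots,a_L)$ and $(b_1,\dots,b_L)$ of distinct numbers are order-isomorphic if for all $i,j$: $a_i<a_j \iff b_i<b_j$. Two subpermutations of a permutation are called twins if they are order-isomorphic and disjoint (share no symbol); their length is their common number of entries. *)

theory Defs
  imports Complex_Main "HOL-Library.Sublist"
begin

definition is_perm_of :: "nat list \<Rightarrow> nat set \<Rightarrow> bool" where
  "is_perm_of a S \<longleftrightarrow> distinct a \<and> set a = S"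

definition order_iso :: "nat list \<Rightarrow> nat list \<Rightarrow> bool" where
  "order_iso xs ys \<longleftrightarrow> length xs = length ys \<and>
     (\<forall>i < length xs. \<forall>j < length xs. xs ! i < xs ! j \<longleftrightarrow> ys ! i < ys ! j)"

definition twins :: "nat list \<Rightarrow> nat list \<Rightarrow> nat list \<Rightarrow> bool" where
  "twins a s t \<longleftrightarrow> subseq s a \<and> subseq t a \<and> set s \<inter> set t = {} \<and> order_iso s t"

end

(* Cut the values into columns (blocks of s consecutive values) and scan the positions from left
   to right.  A stretch of 3 (m^3 + 1) + 2 q positions meeting at most q columns contains m^3 + 1
   triples, each inside one column, whose value ranges are pairwise separated.  Sorting these
   triples by their first, second or third member gives three linear orders, and two of them agree
   on m + 1 triples (the three-dimensional Erdos-Szekeres argument); the two corresponding members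
   of these triples are twins that traverse the columns in parallel.  Discard the stretch and the
   used columns, at a cost of at most (m + 1) s further points, and repeat: twins from different
   rounds concatenate because they occupy different columns.  With m of order n^(1/5), s of order
   n^(2/5) and q about n / s of order n^(3/5), the number r of rounds can be taken of order n^(2/5).
   For small n the two halves of a monotone subsequence suffice. *)

theory Submission
  imports Defs
begin

section \<open>Twins as sets of pairs of positions\<close>

text \<open>Pairs of positions. Injectivity of both projections on \<open>P\<close> is implied.\<close>

definition twin_pairs :: "(nat \<Rightarrow> nat) \<Rightarrow> (nat \<times> nat) set \<Rightarrow> bool" where
  "twin_pairs v P \<longleftrightarrow> fst ` P \<inter> snd ` P = {} \<and>
     (\<forall>p\<in>P. \<forall>q\<in>P. (fst p < fst q \<longleftrightarrow> snd p < snd q) \<and> (v (fst p) < v (fst q) \<longleftrightarrow> v (snd p) < v (snd q)))"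

lemma twin_pairs_inj_fst:
  assumes "twin_pairs v P"
  shows "inj_on fst P"
proof (rule inj_onI)
  fix p q assume "p \<in> P" "q \<in> P" and eq: "fst p = fst q"
  then have "\<not> snd p < snd q" "\<not> snd q < snd p"
    using assms unfolding twin_pairs_def by (metis less_irrefl)+
  with eq show "p = q" by (simp add: prod_eq_iff)
qed

text \<open>A strictly increasing list is determined by its set, so \<open>is\<close> is
  \<open>[0..<length a]\<close> filtered by membership in \<open>is\<close>; \<open>map\<close>
  preserves subsequences.\<close>

lemma subseq_map_nth:
  assumes "sorted_wrt (<) is" "set is \<subseteq> {..<length a}"
  shows "subseq (map ((!) a) is) a"
proof -
  have "is = filter (\<lambda>i. i \<in> set is) [0..<length a]"
  proof (rule strict_sorted_equal[OF _ assms(1)])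
    show "sorted_wrt (<) (filter (\<lambda>i. i \<in> set is) [0..<length a])"
      by (rule sorted_wrt_filter) simp
    show "set is = set (filter (\<lambda>i. i \<in> set is) [0..<length a])"
      using assms(2) by auto
  qed
  then have "subseq is [0..<length a]" by (metis subseq_filter_left)
  then have "subseq (map ((!) a) is) (map ((!) a) [0..<length a])" by (rule subseq_map)
  then show ?thesis by (simp add: map_nth)
qed

text \<open>Both projections order \<open>P\<close> in the same way, so sorting \<open>P\<close> by
  first components also sorts it by second components. The two resulting lists of positions are
  strictly increasing and read off the twins; distinctness of \<open>a\<close> turns disjoint
  positions into disjoint symbols.\<close>

lemma twins_of_twin_pairs:
  assumes tp: "twin_pairs ((!) a) P" and P: "P \<subseteq> {..<length a} \<times> {..<length a}" and "distinct a"
  shows "\<exists>s t. twins a s t \<and> length s = card P"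
proof -
  have fin: "finite P" using P by (rule finite_subset) simp
  obtain qs where "set qs = P" "distinct qs" using finite_distinct_list[OF fin] by blast
  define ps where "ps = sort_key fst qs"
  have ps: "set ps = P" "distinct ps"
    using \<open>set qs = P\<close> \<open>distinct qs\<close> by (simp_all add: ps_def)
  have len: "length ps = card P" using ps distinct_card by fastforce
  have "sorted (map fst ps)" by (simp add: ps_def)
  moreover have "distinct (map fst ps)"
    using ps twin_pairs_inj_fst[OF tp] by (simp add: distinct_map)
  ultimately have sfst: "sorted_wrt (<) (map fst ps)" by (simp add: strict_sorted_iff)
  then have "sorted_wrt (\<lambda>p q. fst p < fst q) ps" by (simp add: sorted_wrt_map)
  then have "sorted_wrt (\<lambda>p q. snd p < snd q) ps"
    by (rule sorted_wrt_mono_rel[rotated]) (use tp ps in \<open>auto simp: twin_pairs_def\<close>)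
  then have ssnd: "sorted_wrt (<) (map snd ps)" by (simp add: sorted_wrt_map)
  let ?s = "map ((!) a) (map fst ps)" and ?t = "map ((!) a) (map snd ps)"
  have "subseq ?s a" by (rule subseq_map_nth[OF sfst]) (use ps P in auto)
  moreover have "subseq ?t a" by (rule subseq_map_nth[OF ssnd]) (use ps P in auto)
  moreover have "set ?s \<inter> set ?t = {}"
  proof -
    have "fst p \<noteq> snd q" if "p \<in> P" "q \<in> P" for p q
      using tp that unfolding twin_pairs_def by blast
    moreover have "fst p < length a" "snd p < length a" if "p \<in> P" for p
      using P that by auto
    ultimately have "a ! fst p \<noteq> a ! snd q" if "p \<in> P" "q \<in> P" for p q
      using that nth_eq_iff_index_eq[OF \<open>distinct a\<close>] by blast
    then show ?thesis using ps by force
  qed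
  moreover have "order_iso ?s ?t"
    using tp unfolding order_iso_def twin_pairs_def ps(1)[symmetric] by auto
  ultimately have "twins a ?s ?t" unfolding twins_def by blast
  then show ?thesis using len by (metis length_map)
qed

section \<open>Chains, antichains and Erdos-Szekeres arguments\<close>

text \<open>Mirsky's argument, by induction on \<open>m\<close>. The minimal elements
  \<open>M\<close> form an antichain. If there are at most \<open>b\<close> of them, deleting them
  leaves more than \<open>m * b\<close> elements, and a chain found there starts at a non-minimal
  element, so it can be extended downwards by one element.\<close>

lemma chain_or_antichain:
  fixes R :: "'a \<Rightarrow> 'a \<Rightarrow> bool"
  assumes "transp R" "irreflp R" "finite A" "m * b < card A"
  shows "(\<exists>xs. sorted_wrt R xs \<and> set xs \<subseteq> A \<and> length xs = Suc m) \<or>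
         (\<exists>C\<subseteq>A. card C = Suc b \<and> (\<forall>x\<in>C. \<forall>y\<in>C. \<not> R x y))"
  using assms(3,4)
proof (induction m arbitrary: A)
  case 0
  then obtain x where "x \<in> A" by fastforce
  then have "sorted_wrt R [x] \<and> set [x] \<subseteq> A \<and> length [x] = Suc 0" by simp
  then show ?case by blast
next
  case (Suc m)
  define M where "M = {x \<in> A. \<forall>y\<in>A. \<not> R y x}"
  show ?case
  proof (cases "b < card M")
    case True
    then obtain C where "C \<subseteq> M" "card C = Suc b"
      by (metis Suc_leI obtain_subset_with_card_n)
    then have "C \<subseteq> A \<and> card C = Suc b \<and> (\<forall>x\<in>C. \<forall>y\<in>C. \<not> R x y)"
      unfolding M_def by blast
    then show ?thesis by blast
  next
    case False
    have "M \<subseteq> A" by (auto simp: M_def)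
    then have "card (A - M) = card A - card M"
      using Suc.prems(1) by (meson card_Diff_subset finite_subset)
    then have "m * b < card (A - M)" using False Suc.prems(2) by simp
    from Suc.IH[OF _ this] Suc.prems(1) consider
      xs where "sorted_wrt R xs" "set xs \<subseteq> A - M" "length xs = Suc m"
      | C where "C \<subseteq> A - M" "card C = Suc b" "\<forall>x\<in>C. \<forall>y\<in>C. \<not> R x y"
      by (metis finite_Diff)
    then show ?thesis
    proof cases
      case 1
      then obtain x ys where xs: "xs = x # ys" by (cases xs) auto
      with 1 have "x \<in> A" "x \<notin> M" by auto
      then obtain y where y: "y \<in> A" "R y x" unfolding M_def by blast
      have "R y z" if "z \<in> set xs" for z
        using that 1 xs y \<open>transp R\<close> by (auto dest: transpD)
      then have "sorted_wrt R (y # xs) \<and> set (y # xs) \<subseteq> A \<and> length (y # xs) = Suc (Suc m)"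
        using 1 y by auto
      then show ?thesis by blast
    next
      case 2
      then show ?thesis by blast
    qed
  qed
qed

lemma chain_set_or_antichain:
  fixes R :: "'a \<Rightarrow> 'a \<Rightarrow> bool"
  assumes "transp R" "irreflp R" "finite A" "m * b < card A"
  shows "(\<exists>C\<subseteq>A. card C = Suc m \<and> (\<forall>x\<in>C. \<forall>y\<in>C. x = y \<or> R x y \<or> R y x)) \<or>
         (\<exists>C\<subseteq>A. card C = Suc b \<and> (\<forall>x\<in>C. \<forall>y\<in>C. \<not> R x y))"
  using chain_or_antichain[OF assms]
proof (elim disjE exE conjE)
  fix xs assume xs: "sorted_wrt R xs" "set xs \<subseteq> A" "length xs = Suc m"
  then have tot: "\<forall>x\<in>set xs. \<forall>y\<in>set xs. x = y \<or> R x y \<or> R y x"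
    by (metis in_set_conv_nth linorder_neqE_nat sorted_wrt_iff_nth_less)
  have "distinct xs"
    unfolding distinct_conv_nth using xs(1) \<open>irreflp R\<close>
    by (metis irreflpD linorder_neqE_nat sorted_wrt_iff_nth_less)
  then have "card (set xs) = Suc m" using xs(3) distinct_card by fastforce
  with tot xs(2) show ?thesis by blast
qed blast

text \<open>The Erdos-Szekeres theorem: take the order in which positions and values both increase.
  Its chains are increasing subsequences, and by injectivity of \<open>v\<close> its antichains are
  decreasing ones.\<close>

lemma monotone_subset:
  fixes v :: "nat \<Rightarrow> nat"
  assumes "finite A" "inj_on v A" "m * m < card A"
  shows "\<exists>C\<subseteq>A. card C = Suc m \<and>
    ((\<forall>i\<in>C. \<forall>j\<in>C. i < j \<longrightarrow> v i < v j) \<or> (\<forall>i\<in>C. \<forall>j\<in>C. i < j \<longrightarrow> v j < v i))"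
proof -
  let ?R = "\<lambda>i j. i < j \<and> v i < v j"
  have "transp ?R" "irreflp ?R" by (auto intro!: transpI irreflpI)
  from chain_set_or_antichain[OF this assms(1,3)]
  consider C where "C \<subseteq> A" "card C = Suc m" "\<forall>i\<in>C. \<forall>j\<in>C. i = j \<or> ?R i j \<or> ?R j i"
    | C where "C \<subseteq> A" "card C = Suc m" "\<forall>i\<in>C. \<forall>j\<in>C. \<not> ?R i j" by blast
  then show ?thesis
  proof cases
    case 1
    then show ?thesis by (metis less_asym)
  next
    case 2
    have "v j < v i" if "i \<in> C" "j \<in> C" "i < j" for i j
    proof -
      have "v i \<noteq> v j" using that 2(1) assms(2) by (metis inj_on_def less_irrefl subsetD)
      with 2(3) that show ?thesis by (metis linorder_neqE_nat)
    qed
    with 2 show ?thesis by blast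
  qed
qed

text \<open>If orders 0 and 1 have no common chain of size \<open>m + 1\<close>, they are opposite
  on a set \<open>D\<close> of size \<open>m * m + 1\<close>. If orders 0 and 2 have no common chain
  of that size in \<open>D\<close>, they are opposite on a subset \<open>C\<close> of size
  \<open>m + 1\<close>. There orders 1 and 2 both reverse order 0, so they agree.\<close>

lemma two_of_three_orders_agree:
  fixes f :: "nat \<Rightarrow> 'a \<Rightarrow> nat"
  assumes "finite A" "\<And>k. k < 3 \<Longrightarrow> inj_on (f k) A" "m ^ 3 < card A"
  shows "\<exists>C\<subseteq>A. card C = Suc m \<and> (\<exists>i<3. \<exists>j<3. i \<noteq> j \<and> (\<forall>x\<in>C. \<forall>y\<in>C. f i x < f i y \<longleftrightarrow> f j x < f j y))"
proof -
  let ?R = "\<lambda>i j x y. f i x < f i y \<and> f j x < f j y"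
  have R: "transp (?R i j)" "irreflp (?R i j)" for i j by (auto intro!: transpI irreflpI)
  have chain: ?thesis if "i < 3" "j < 3" "i \<noteq> j" "C \<subseteq> A" "card C = Suc m"
    "\<forall>x\<in>C. \<forall>y\<in>C. x = y \<or> ?R i j x y \<or> ?R i j y x" for i j C
  proof -
    have "\<forall>x\<in>C. \<forall>y\<in>C. f i x < f i y \<longleftrightarrow> f j x < f j y"
      using that(6) by (metis less_asym less_irrefl)
    with that(1-5) show ?thesis by blast
  qed
  have "m * (m * m) < card A" using assms(3) by (simp add: power3_eq_cube mult.assoc)
  from chain_set_or_antichain[OF R assms(1) this, of 0 1]
  consider "\<exists>C\<subseteq>A. card C = Suc m \<and> (\<forall>x\<in>C. \<forall>y\<in>C. x = y \<or> ?R 0 1 x y \<or> ?R 0 1 y x)"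
    | D where "D \<subseteq> A" "card D = Suc (m * m)" "\<forall>x\<in>D. \<forall>y\<in>D. \<not> ?R 0 1 x y" by blast
  then show ?thesis
  proof cases
    case 1
    then show ?thesis using chain[of 0 1] by auto
  next
    case 2
    have "finite D" using 2(1) assms(1) finite_subset by blast
    moreover have "m * m < card D" using 2 by simp
    ultimately consider C where "C \<subseteq> D" "card C = Suc m" "\<forall>x\<in>C. \<forall>y\<in>C. x = y \<or> ?R 0 2 x y \<or> ?R 0 2 y x"
      | C where "C \<subseteq> D" "card C = Suc m" "\<forall>x\<in>C. \<forall>y\<in>C. \<not> ?R 0 2 x y"
      using chain_set_or_antichain[OF R, of D m m 0 2] by blast
    then show ?thesis
    proof cases
      case 1
      then have "C \<subseteq> A" using 2(1) by blast
      with 1 show ?thesis using chain[of 0 2 C] by simp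
    next
      case C: 2
      have "x = y \<or> ?R 1 2 x y \<or> ?R 1 2 y x" if "x \<in> C" "y \<in> C" for x y
      proof (cases "x = y")
        case False
        have "f k x \<noteq> f k y" if "k < 3" for k
          using assms(2)[OF that] False \<open>x \<in> C\<close> \<open>y \<in> C\<close> C(1) 2(1) by (meson inj_onD subsetD)
        from this[of 0] this[of 1] this[of 2]
        have "f 0 x \<noteq> f 0 y" "f 1 x \<noteq> f 1 y" "f 2 x \<noteq> f 2 y" by simp_all
        moreover have "\<not> ?R 0 1 x y" "\<not> ?R 0 1 y x" "\<not> ?R 0 2 x y" "\<not> ?R 0 2 y x"
          using that C 2 by blast+
        ultimately show ?thesis by linarith
      qed simp
      moreover have "C \<subseteq> A" using C(1) 2(1) by blast
      ultimately show ?thesis using chain[of 1 2 C] C(2) by simp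
    qed
  qed
qed

section \<open>Separated triples and the twins inside one stretch\<close>

text \<open>Serves twice: with \<open>f = v\<close> to take the three lowest points of a column, and
  with the identity to cut off an initial stretch of positions.\<close>

lemma smallest_subset:
  fixes f :: "'a \<Rightarrow> nat"
  assumes "finite S" "inj_on f S" "m \<le> card S"
  shows "\<exists>B\<subseteq>S. card B = m \<and> (\<forall>b\<in>B. \<forall>c\<in>S - B. f b < f c)"
  using assms(3)
proof (induction m)
  case 0
  show ?case by (rule exI[of _ "{}"]) simp
next
  case (Suc m)
  then obtain B where B: "B \<subseteq> S" "card B = m" "\<forall>b\<in>B. \<forall>c\<in>S - B. f b < f c" by auto
  have "S - B \<noteq> {}"
    using B Suc.prems by auto
  then obtain x where x: "x \<in> S - B" and "\<forall>y\<in>S - B. f x \<le> f y"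
    using assms(1) arg_min_if_finite(1)[of "S - B" f] arg_min_least[of "S - B" _ f] by blast
  then have "f x < f y" if "y \<in> S - insert x B" for y
    using that assms(2) by (metis DiffD1 DiffD2 DiffI inj_on_def insertCI nat_less_le)
  with B x have "\<forall>b\<in>insert x B. \<forall>c\<in>S - insert x B. f b < f c" by blast
  moreover have "card (insert x B) = Suc m"
    using B x assms(1) by (simp add: finite_subset)
  moreover have "insert x B \<subseteq> S" using B x by blast
  ultimately show ?case by blast
qed

text \<open>Greedy choice: as long as more than two points per column remain, some column holds
  three, and its three lowest points are removed as a triple. Each removal costs 3 points and
  creates no new column, so the cardinality hypothesis survives the induction. Here \<open>g\<close>
  sends a value to its column.\<close>

lemma separated_triples:
  fixes v :: "'a \<Rightarrow> nat" and g :: "nat \<Rightarrow> nat"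
  assumes "mono g" "finite B" "inj_on v B" "3 * K + 2 * card ((\<lambda>i. g (v i)) ` B) \<le> card B"
  shows "\<exists>\<T>. finite \<T> \<and> card \<T> = K \<and> (\<forall>T\<in>\<T>. T \<subseteq> B \<and> card T = 3 \<and> (\<forall>i\<in>T. \<forall>j\<in>T. g (v i) = g (v j))) \<and>
    (\<forall>T\<in>\<T>. \<forall>U\<in>\<T>. T \<noteq> U \<longrightarrow> (\<forall>i\<in>T. \<forall>j\<in>U. v i < v j) \<or> (\<forall>i\<in>T. \<forall>j\<in>U. v j < v i))"
  using assms(2-)
proof (induction K arbitrary: B)
  case 0
  show ?case by (rule exI[of _ "{}"]) simp
next
  case (Suc K)
  let ?h = "\<lambda>i. g (v i)"
  \<comment> \<open>Pigeonhole: the hypothesis for \<open>Suc K\<close> leaves at least 3 points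
    beyond two per column.\<close>
  have "\<exists>c\<in>?h ` B. 2 < card {i\<in>B. ?h i = c}"
  proof (rule ccontr)
    assume "\<not> ?thesis"
    then have "(\<Sum>c\<in>?h ` B. card {i\<in>B. ?h i = c}) \<le> (\<Sum>c\<in>?h ` B. 2)"
      by (intro sum_mono) (auto simp: not_less)
    moreover have "card B = (\<Sum>c\<in>?h ` B. card {i\<in>B. ?h i = c})"
      using Suc.prems(1) unfolding card_eq_sum by (rule sum.image_gen)
    ultimately show False using Suc.prems(3) by simp
  qed
  then obtain c where "2 < card {i\<in>B. ?h i = c}" by blast
  then have c: "3 \<le> card {i\<in>B. ?h i = c}" by linarith
  have "finite {i\<in>B. ?h i = c}" "inj_on v {i\<in>B. ?h i = c}"
    using Suc.prems(1,2) by (auto intro: inj_on_subset)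
  from smallest_subset[OF this c] obtain T where T: "T \<subseteq> {i\<in>B. ?h i = c}" "card T = 3"
    "\<forall>b\<in>T. \<forall>i\<in>{i\<in>B. ?h i = c} - T. v b < v i"
    by blast
  have "finite T" using T(2) by (metis card.infinite zero_neq_numeral)
  then have "card (B - T) = card B - 3" using T by (subst card_Diff_subset) auto
  moreover have "card (?h ` (B - T)) \<le> card (?h ` B)"
    using Suc.prems(1) by (intro card_mono) auto
  ultimately have "3 * K + 2 * card (?h ` (B - T)) \<le> card (B - T)" using Suc.prems(3) by simp
  from Suc.IH[OF finite_Diff[OF Suc.prems(1)] inj_on_subset[OF Suc.prems(2) Diff_subset] this]
  obtain \<T> where \<T>: "finite \<T>" "card \<T> = K"
    "\<forall>T'\<in>\<T>. T' \<subseteq> B - T \<and> card T' = 3 \<and> (\<forall>i\<in>T'. \<forall>j\<in>T'. ?h i = ?h j)"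
    "\<forall>T\<in>\<T>. \<forall>U\<in>\<T>. T \<noteq> U \<longrightarrow> (\<forall>i\<in>T. \<forall>j\<in>U. v i < v j) \<or> (\<forall>i\<in>T. \<forall>j\<in>U. v j < v i)"
    by (elim exE conjE) (rule that)
  \<comment> \<open>A later triple in another column is separated from \<open>T\<close> because
    \<open>g\<close> is monotone; one in the same column lies above \<open>T\<close> because
    \<open>T\<close> took the lowest points there.\<close>
  have sep: "(\<forall>i\<in>T. \<forall>j\<in>U. v i < v j) \<or> (\<forall>i\<in>T. \<forall>j\<in>U. v j < v i)" if "U \<in> \<T>" for U
  proof -
    have U: "U \<subseteq> B - T" "card U = 3" "\<forall>i\<in>U. \<forall>j\<in>U. ?h i = ?h j"
      using bspec[OF \<T>(3) that] by blast+
    then obtain u where u: "u \<in> U" by fastforce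
    have hU: "?h i = ?h u" if "i \<in> U" for i using U(3) u that by blast
    have hT: "?h i = c" if "i \<in> T" for i using T(1) that by blast
    have less: "x < y" if "g x < g y" for x y
      using that \<open>mono g\<close> by (metis leD leI monoD)
    consider "?h u < c" | "?h u = c" | "c < ?h u" by linarith
    then show ?thesis
    proof cases
      case 1
      then show ?thesis using hU hT less by metis
    next
      case 2
      then have "U \<subseteq> {i\<in>B. ?h i = c} - T" using U(1) hU by auto
      then show ?thesis using T(3) by blast
    next
      case 3
      then show ?thesis using hU hT less by metis
    qed
  qed
  have "T \<notin> \<T>"
  proof
    assume "T \<in> \<T>"
    from bspec[OF \<T>(3) this] have "T = {}" by blast
    with T(2) show False by simp
  qed
  then have "card (insert T \<T>) = Suc K" using \<T>(1,2) by simp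
  moreover have "\<forall>T'\<in>insert T \<T>. T' \<subseteq> B \<and> card T' = 3 \<and> (\<forall>i\<in>T'. \<forall>j\<in>T'. ?h i = ?h j)"
  proof
    fix T' assume "T' \<in> insert T \<T>"
    then consider "T' = T" | "T' \<in> \<T>" by blast
    then show "T' \<subseteq> B \<and> card T' = 3 \<and> (\<forall>i\<in>T'. \<forall>j\<in>T'. ?h i = ?h j)"
    proof cases
      case 1
      then show ?thesis using T(1,2) by auto
    next
      case 2
      from bspec[OF \<T>(3) this] show ?thesis by blast
    qed
  qed
  moreover have "\<forall>T'\<in>insert T \<T>. \<forall>U\<in>insert T \<T>. T' \<noteq> U \<longrightarrow>
      (\<forall>i\<in>T'. \<forall>j\<in>U. v i < v j) \<or> (\<forall>i\<in>T'. \<forall>j\<in>U. v j < v i)"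
  proof (intro ballI impI)
    fix T' U assume TU: "T' \<in> insert T \<T>" "U \<in> insert T \<T>" "T' \<noteq> U"
    then consider "T' = T" "U \<in> \<T>" | "U = T" "T' \<in> \<T>" | "T' \<in> \<T>" "U \<in> \<T>" by blast
    then show "(\<forall>i\<in>T'. \<forall>j\<in>U. v i < v j) \<or> (\<forall>i\<in>T'. \<forall>j\<in>U. v j < v i)"
    proof cases
      case 1
      then show ?thesis using sep by blast
    next
      case 2
      then show ?thesis using sep[of T'] by blast
    next
      case 3
      then show ?thesis using \<T>(4) TU(3) by blast
    qed
  qed
  moreover have "finite (insert T \<T>)" using \<T>(1) by simp
  ultimately show ?case by (intro exI conjI)
qed

text \<open>Two separated triples compare by value in the same way whichever members represent them,
  so only the orders of position have to agree. The positions of the members numbered 0, 1 and 2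
  give three linear orders on the triples; two of them, numbered \<open>i\<close> and
  \<open>j\<close>, agree on \<open>m + 1\<close> triples, and the pairs consist of these two
  members.\<close>

lemma twin_pairs_in_block:
  fixes v g :: "nat \<Rightarrow> nat"
  assumes "mono g" "finite B" "inj_on v B" "3 * (m ^ 3 + 1) + 2 * card ((\<lambda>i. g (v i)) ` B) \<le> card B"
  shows "\<exists>P\<subseteq>B \<times> B. twin_pairs v P \<and> card P = Suc m \<and> (\<forall>p\<in>P. g (v (fst p)) = g (v (snd p)))"
proof -
  obtain \<T> where \<T>: "finite \<T>" "card \<T> = m ^ 3 + 1"
    "\<forall>T\<in>\<T>. T \<subseteq> B \<and> card T = 3 \<and> (\<forall>i\<in>T. \<forall>j\<in>T. g (v i) = g (v j))"
    "\<forall>T\<in>\<T>. \<forall>U\<in>\<T>. T \<noteq> U \<longrightarrow> (\<forall>i\<in>T. \<forall>j\<in>U. v i < v j) \<or> (\<forall>i\<in>T. \<forall>j\<in>U. v j < v i)"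
    using separated_triples[OF assms] by (elim exE conjE) (rule that)
  \<comment> \<open>\<open>e T\<close> is an arbitrary numbering of the triple; it is not assumed to
    follow positions or values.\<close>
  have "\<exists>e. bij_betw e {0..<3::nat} T" if "T \<in> \<T>" for T
  proof -
    have "card T = 3" using \<T>(3) that by blast
    moreover from this have "finite T" by (metis card.infinite zero_neq_numeral)
    ultimately show ?thesis using ex_bij_betw_nat_finite[of T] by simp
  qed
  then obtain e where e: "\<And>T. T \<in> \<T> \<Longrightarrow> bij_betw (e T) {0..<3::nat} T"
    using bchoice[of \<T> "\<lambda>T e. bij_betw e {0..<3} T"] by blast
  have eT: "e T k \<in> T" if "T \<in> \<T>" "k < 3" for T k
    using bij_betwE[OF e[OF that(1)]] that(2) by auto
  \<comment> \<open>Separated triples are disjoint, so a position determines its triple and its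
    number there. This makes the three orders linear and keeps the two twins disjoint.\<close>
  have e_eq: "T = U \<and> k = l" if "T \<in> \<T>" "U \<in> \<T>" "k < 3" "l < 3" "e T k = e U l" for T U k l
  proof
    show "T = U"
    proof (rule ccontr)
      assume "T \<noteq> U"
      then have "(\<forall>i\<in>T. \<forall>j\<in>U. v i < v j) \<or> (\<forall>i\<in>T. \<forall>j\<in>U. v j < v i)"
        using \<T>(4) that(1,2) by blast
      moreover have "e T k \<in> T" "e T k \<in> U" using eT[of T k] eT[of U l] that by simp_all
      ultimately show False by blast
    qed
    then show "k = l"
      using bij_betw_imp_inj_on[OF e[OF that(1)]] that by (simp add: inj_on_def)
  qed
  have "inj_on (\<lambda>T. e T k) \<T>" if "k < 3" for k
    using e_eq that by (blast intro: inj_onI)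
  then obtain C i j where C: "C \<subseteq> \<T>" "card C = Suc m" "i < 3" "j < 3" "i \<noteq> j"
    "\<forall>T\<in>C. \<forall>U\<in>C. e T i < e U i \<longleftrightarrow> e T j < e U j"
    using two_of_three_orders_agree[OF \<T>(1), of "\<lambda>k T. e T k" m] \<T>(2) by auto
  define P where "P = (\<lambda>T. (e T i, e T j)) ` C"
  have "inj_on (\<lambda>T. (e T i, e T j)) C"
    by (rule inj_onI) (use e_eq[OF _ _ C(3) C(3)] C(1) in blast)
  then have "card P = Suc m" using C(2) by (simp add: P_def card_image)
  moreover have "P \<subseteq> B \<times> B" using C(1,3,4) eT \<T>(3) unfolding P_def by blast
  moreover have "\<forall>p\<in>P. g (v (fst p)) = g (v (snd p))"
    using C(1,3,4) eT \<T>(3) unfolding P_def by auto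
  moreover have "twin_pairs v P"
    unfolding twin_pairs_def
  proof (intro conjI ballI)
    have "e T i \<noteq> e U j" if "T \<in> C" "U \<in> C" for T U
      using e_eq[of T U i j] C(1,3,4,5) that by blast
    then show "fst ` P \<inter> snd ` P = {}" unfolding P_def by auto
  next
    fix p q assume "p \<in> P" "q \<in> P"
    then obtain T U where TU: "T \<in> C" "U \<in> C" "p = (e T i, e T j)" "q = (e U i, e U j)"
      unfolding P_def by blast
    then show "fst p < fst q \<longleftrightarrow> snd p < snd q" using C(6) by simp
    show "v (fst p) < v (fst q) \<longleftrightarrow> v (snd p) < v (snd q)"
    proof (cases "T = U")
      case False
      then have "(\<forall>i\<in>T. \<forall>j\<in>U. v i < v j) \<or> (\<forall>i\<in>T. \<forall>j\<in>U. v j < v i)"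
        using \<T>(4) TU C(1) by blast
      moreover have "e T i \<in> T" "e T j \<in> T" "e U i \<in> U" "e U j \<in> U"
        using TU C(1,3,4) eT by blast+
      ultimately show ?thesis using TU(3,4) by (metis fst_conv snd_conv less_asym)
    qed (use TU in simp)
  qed
  ultimately show ?thesis by blast
qed

section \<open>Iteration over rounds\<close>

lemma card_value_block_le:
  fixes v :: "nat \<Rightarrow> nat"
  assumes "0 < s" "inj_on v S"
  shows "card {i\<in>S. v i div s = c} \<le> s"
proof -
  have "card {i\<in>S. v i div s = c} = card (v ` {i\<in>S. v i div s = c})"
    using assms(2) by (intro card_image[symmetric]) (auto intro: inj_on_subset)
  also have "\<dots> \<le> card {c * s..<c * s + s}"
    using assms(1) by (intro card_mono) (auto simp: div_mult_mod_eq dividend_less_div_times dividend_less_times_div add.commute mult.commute)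
  finally show ?thesis by simp
qed

text \<open>Each round consumes a stretch of \<open>3 * (m ^ 3 + 1) + 2 * q\<close> positions and at
  most \<open>Suc m * s\<close> points in the columns of its \<open>Suc m\<close> pairs. That both
  members of a pair share a column is part of the conclusion because the induction needs it to
  compare pairs from different rounds.\<close>

lemma twin_pairs_iterate:
  fixes v :: "nat \<Rightarrow> nat"
  assumes "0 < s" "finite S" "inj_on v S" "card ((\<lambda>i. v i div s) ` S) \<le> q"
    "r * (3 * (m ^ 3 + 1) + 2 * q + Suc m * s) \<le> card S"
  shows "\<exists>P\<subseteq>S \<times> S. twin_pairs v P \<and> card P = r * Suc m \<and> (\<forall>p\<in>P. v (fst p) div s = v (snd p) div s)"
  using assms(2-)
proof (induction r arbitrary: S)
  case 0
  show ?case by (rule exI[of _ "{}"]) (simp add: twin_pairs_def)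
next
  case (Suc r)
  let ?h = "\<lambda>i. v i div s" and ?w = "3 * (m ^ 3 + 1) + 2 * q"
  have "?w \<le> card S" using Suc.prems(4) by simp
  \<comment> \<open>\<open>B\<close> is the leftmost stretch of \<open>S\<close>, so whatever the
    later rounds find lies to its right.\<close>
  then obtain B where B: "B \<subseteq> S" "card B = ?w" "\<forall>b\<in>B. \<forall>c\<in>S - B. b < c"
    using smallest_subset[of S "\<lambda>i. i" ?w] Suc.prems(1) by auto
  have "finite B" "inj_on v B" using B(1) Suc.prems(1,2) finite_subset inj_on_subset by blast+
  moreover have "card (?h ` B) \<le> q"
    using B(1) Suc.prems(1,3) by (meson card_mono finite_imageI image_mono order_trans)
  moreover have "mono (\<lambda>x. x div s)" by (simp add: monoI div_le_mono)
  ultimately obtain P where P: "P \<subseteq> B \<times> B" "twin_pairs v P" "card P = Suc m"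
      "\<forall>p\<in>P. ?h (fst p) = ?h (snd p)"
    using twin_pairs_in_block[of "\<lambda>x. x div s" B v m] B(2) by fastforce
  have finP: "finite P" using P(1) \<open>finite B\<close> by (meson finite_SigmaI finite_subset)
  \<comment> \<open>\<open>D\<close> collects all points of \<open>S\<close> in the columns used by
    \<open>P\<close>; first members suffice to name these columns, since each pair stays in one
    column.\<close>
  define D where "D = {i\<in>S. ?h i \<in> ?h ` fst ` P}"
  define S' where "S' = S - (B \<union> D)"
  have "D = (\<Union>p\<in>P. {i\<in>S. ?h i = ?h (fst p)})" unfolding D_def by auto
  then have "card D \<le> (\<Sum>p\<in>P. card {i\<in>S. ?h i = ?h (fst p)})"
    using finP by (simp add: card_UN_le)
  also have "\<dots> \<le> (\<Sum>p\<in>P. s)"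
    by (intro sum_mono card_value_block_le assms(1) Suc.prems(2))
  finally have "card D \<le> Suc m * s" using P(3) by simp
  then have "card (B \<union> D) \<le> ?w + Suc m * s" using card_Un_le[of B D] B(2) by linarith
  moreover have "card S - card (B \<union> D) \<le> card S'"
    unfolding S'_def by (rule diff_card_le_card_Diff) (simp add: \<open>finite B\<close> D_def Suc.prems(1))
  ultimately have "r * (?w + Suc m * s) \<le> card S'" using Suc.prems(4) unfolding mult_Suc by linarith
  moreover have "finite S'" "inj_on v S'" "card (?h ` S') \<le> q"
    unfolding S'_def using Suc.prems(1,2,3)
    by (auto intro: inj_on_subset order_trans[OF card_mono[OF _ image_mono]])
  ultimately obtain Q where Q: "Q \<subseteq> S' \<times> S'" "twin_pairs v Q" "card Q = r * Suc m"
      "\<forall>p\<in>Q. ?h (fst p) = ?h (snd p)"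
    using Suc.IH[of S'] by blast
  have finQ: "finite Q" using Q(1) \<open>finite S'\<close> by (meson finite_SigmaI finite_subset)
  have inB: "fst p \<in> B" "snd p \<in> B" if "p \<in> P" for p using that P(1) by auto
  have inS': "fst p \<in> S'" "snd p \<in> S'" if "p \<in> Q" for p using that Q(1) by auto
  have BS': "x < y" if "x \<in> B" "y \<in> S'" for x y using that B(3) S'_def by blast
  have "P \<inter> Q = {}" using inB inS' S'_def by blast
  then have "card (P \<union> Q) = Suc r * Suc m"
    using finP finQ P(3) Q(3) by (simp add: card_Un_disjoint)
  moreover have "P \<union> Q \<subseteq> S \<times> S" using P(1) Q(1) B(1) S'_def by blast
  moreover have "twin_pairs v (P \<union> Q)"
  proof -
    have dP: "fst ` P \<inter> snd ` P = {}" and dQ: "fst ` Q \<inter> snd ` Q = {}"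
      using P(2) Q(2) by (auto simp: twin_pairs_def)
    have "fst ` (P \<union> Q) \<inter> snd ` (P \<union> Q) = {}"
    proof -
      have "fst p \<noteq> snd q" "fst q \<noteq> snd p" if "p \<in> P" "q \<in> Q" for p q
        using inB[OF that(1)] inS'[OF that(2)] S'_def by auto
      then show ?thesis using dP dQ by (simp add: image_Un Int_Un_distrib Int_Un_distrib2) blast
    qed
    \<comment> \<open>By position, \<open>p\<close> precedes \<open>q\<close> in both members. By
      value, the two pairs occupy different columns, and the order of the columns decides both
      comparisons alike.\<close>
    moreover have cross: "(fst p < fst q \<longleftrightarrow> snd p < snd q) \<and> (fst q < fst p \<longleftrightarrow> snd q < snd p) \<and>
       (v (fst p) < v (fst q) \<longleftrightarrow> v (snd p) < v (snd q)) \<and> (v (fst q) < v (fst p) \<longleftrightarrow> v (snd q) < v (snd p))"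
      if "p \<in> P" "q \<in> Q" for p q
    proof -
      have "fst q \<notin> D" "fst q \<in> S" using inS'[OF that(2)] S'_def by auto
      then have ne: "?h (fst q) \<noteq> ?h (fst p)" using that(1) unfolding D_def by blast
      have less: "x < y" if "x div s < y div s" for x y
        using that by (meson div_le_mono leD leI)
      have "fst p < fst q" "snd p < snd q" using inB inS' BS' that by blast+
      moreover have "?h (fst p) = ?h (snd p)" "?h (fst q) = ?h (snd q)" using P(4) Q(4) that by auto
      ultimately show ?thesis using ne less by (metis less_asym linorder_neqE_nat)
    qed
    moreover have "(fst p < fst q \<longleftrightarrow> snd p < snd q) \<and> (v (fst p) < v (fst q) \<longleftrightarrow> v (snd p) < v (snd q))"
      if pq: "p \<in> P \<union> Q" "q \<in> P \<union> Q" for p q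
    proof -
      consider "p \<in> P" "q \<in> P" | "p \<in> Q" "q \<in> Q" | "p \<in> P" "q \<in> Q" | "q \<in> P" "p \<in> Q"
        using pq by blast
      then show ?thesis
      proof cases
        case 1
        then show ?thesis using P(2) by (simp add: twin_pairs_def)
      next
        case 2
        then show ?thesis using Q(2) by (simp add: twin_pairs_def)
      next
        case 3
        then show ?thesis using cross[of p q] by blast
      next
        case 4
        then show ?thesis using cross[of q p] by blast
      qed
    qed
    ultimately show ?thesis unfolding twin_pairs_def by (intro conjI ballI) auto
  qed
  moreover have "\<forall>p\<in>P \<union> Q. ?h (fst p) = ?h (snd p)" using P(4) Q(4) by blast
  ultimately show ?case by blast
qed

section \<open>Twins from a monotone subsequence\<close>

text \<open>Erdos-Szekeres with \<open>2 * h - 1\<close> yields a monotone subsequence of length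
  \<open>2 * h\<close>. Its first and second halves are twins, entry \<open>k\<close> being paired
  with entry \<open>h + k\<close>.\<close>

lemma twin_pairs_of_monotone_subset:
  fixes v :: "nat \<Rightarrow> nat"
  assumes "finite A" "inj_on v A" "0 < h" "(2 * h - 1)\<^sup>2 < card A"
  shows "\<exists>P\<subseteq>A \<times> A. twin_pairs v P \<and> card P = h"
proof -
  obtain C where C: "C \<subseteq> A" "card C = 2 * h"
    "(\<forall>i\<in>C. \<forall>j\<in>C. i < j \<longrightarrow> v i < v j) \<or> (\<forall>i\<in>C. \<forall>j\<in>C. i < j \<longrightarrow> v j < v i)"
    using monotone_subset[OF assms(1,2), of "2 * h - 1"] assms(3,4) by (auto simp: power2_eq_square)
  define l where "l = sorted_list_of_set C"
  have "finite C" using C(1) assms(1) finite_subset by blast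
  then have l: "sorted_wrt (<) l" "set l = C" "length l = 2 * h"
    using C(2) by (simp_all add: l_def)
  have less: "l ! i < l ! j \<longleftrightarrow> i < j" if "i < 2 * h" "j < 2 * h" for i j
    using that l(1,3) by (metis less_asym linorder_neqE_nat sorted_wrt_nth_less)
  have vless: "(\<forall>i<2*h. \<forall>j<2*h. v (l ! i) < v (l ! j) \<longleftrightarrow> i < j) \<or>
     (\<forall>i<2*h. \<forall>j<2*h. v (l ! i) < v (l ! j) \<longleftrightarrow> j < i)"
    using C(3)
  proof
    assume "\<forall>i\<in>C. \<forall>j\<in>C. i < j \<longrightarrow> v i < v j"
    then have "\<forall>i<2*h. \<forall>j<2*h. v (l ! i) < v (l ! j) \<longleftrightarrow> i < j"
      using less l(2,3) by (metis less_asym linorder_neqE_nat nth_mem)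
    then show ?thesis ..
  next
    assume "\<forall>i\<in>C. \<forall>j\<in>C. i < j \<longrightarrow> v j < v i"
    then have "\<forall>i<2*h. \<forall>j<2*h. v (l ! i) < v (l ! j) \<longleftrightarrow> j < i"
      using less l(2,3) by (metis less_asym linorder_neqE_nat nth_mem)
    then show ?thesis ..
  qed
  define P where "P = (\<lambda>k. (l ! k, l ! (h + k))) ` {..<h}"
  have "inj_on (\<lambda>k. (l ! k, l ! (h + k))) {..<h}"
    using less by (intro inj_onI) (metis Pair_inject lessThan_iff less_irrefl linorder_neqE_nat mult_2 trans_less_add1)
  then have "card P = h" by (simp add: P_def card_image)
  moreover have "P \<subseteq> A \<times> A"
    using C(1) l(2,3) nth_mem[of _ l] unfolding P_def by fastforce
  moreover have "twin_pairs v P"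
    unfolding twin_pairs_def
  proof (intro conjI ballI)
    have "l ! i \<noteq> l ! (h + k)" if "i < h" "k < h" for i k
      using less[of i "h + k"] that by auto
    then show "fst ` P \<inter> snd ` P = {}" unfolding P_def by auto
  next
    fix p q assume "p \<in> P" "q \<in> P"
    then obtain i j where ij: "i < h" "j < h" "p = (l ! i, l ! (h + i))" "q = (l ! j, l ! (h + j))"
      unfolding P_def by blast
    then show "fst p < fst q \<longleftrightarrow> snd p < snd q" by (simp add: less)
    show "v (fst p) < v (fst q) \<longleftrightarrow> v (snd p) < v (snd q)"
      using vless ij by (auto)
  qed
  ultimately show ?thesis by blast
qed

section \<open>Numerical estimates and choice of parameters\<close>

text \<open>The total cost of \<open>r\<close> rounds, with \<open>z\<close> standing for n^(1/5),
  \<open>x\<close> for \<open>m + 1\<close> and \<open>q\<close> for the number of columns. The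
  rounding errors are of lower order, and \<open>8 \<le> z\<close> absorbs them into slightly larger
  constants; the final coefficient is 4/7 + 11/30 = 197/210.\<close>

lemma rounds_cost_le:
  fixes z x s q r :: real
  assumes "8 \<le> z" "z / 2 \<le> x" "x \<le> z / 2 + 1" "0 \<le> s" "s \<le> 2 * z\<^sup>2 + 1" "0 \<le> q" "q \<le> z ^ 3 / 2 + 1"
    "0 \<le> r" "r \<le> z ^ 3 / (8 * x) + 1"
  shows "r * (3 * x ^ 3 + 2 * q + x * s) \<le> z ^ 5"
proof -
  have x: "0 < x" using assms by linarith
  have z2: "8 * z \<le> z\<^sup>2" "64 \<le> z\<^sup>2"
    using assms(1) mult_mono[of 8 z z z] mult_mono[of 8 z 8 z] by (auto simp: power2_eq_square)
  have z3: "z ^ 3 = z * z\<^sup>2" by (simp add: power3_eq_cube power2_eq_square)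
  have z3': "64 * z \<le> z ^ 3" "512 \<le> z ^ 3"
    using mult_left_mono[OF z2(2), of z] assms(1) unfolding z3 by (linarith, linarith)
  \<comment> \<open>The product \<open>r * x\<close> is bounded as a whole: rounding
    \<open>r\<close> up adds only one \<open>x\<close>, which the step from 1/8 to 1/7
    covers.\<close>
  have "r * x \<le> (z ^ 3 / (8 * x) + 1) * x" using assms(9) x by (intro mult_right_mono) auto
  also have "\<dots> = z ^ 3 / 8 + x" using x by (simp add: field_simps)
  also have "\<dots> \<le> z ^ 3 / 7" using assms(3) z3' by linarith
  finally have rx: "r * x \<le> z ^ 3 / 7" .
  have "r * (z / 2) \<le> r * x" using assms by (intro mult_left_mono) auto
  then have "r * (z / 2) \<le> z ^ 3 / 7" using rx by linarith
  then have r: "r \<le> z\<^sup>2 / 3" using assms(1) z2(2) unfolding z3 by (simp add: field_simps)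
  have "x \<le> 5 / 8 * z" using assms(1,3) by linarith
  then have "x\<^sup>2 \<le> (5 / 8 * z)\<^sup>2" using x by (intro power_mono) auto
  then have "3 * x\<^sup>2 + s \<le> 4 * z\<^sup>2" using assms(5) z2 by (simp add: power_mult_distrib power2_eq_square)
  then have 1: "(r * x) * (3 * x\<^sup>2 + s) \<le> (z ^ 3 / 7) * (4 * z\<^sup>2)"
    using rx assms(1,4) z3' by (intro mult_mono) auto
  have q: "2 * q \<le> 11 / 10 * z ^ 3" using assms(7) z3' by linarith
  have 2: "r * (2 * q) \<le> (z\<^sup>2 / 3) * (11 / 10 * z ^ 3)"
    by (rule mult_mono[OF r q]) (use assms(6) in auto)
  have "r * (3 * x ^ 3 + 2 * q + x * s) = (r * x) * (3 * x\<^sup>2 + s) + r * (2 * q)"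
    by (simp add: power3_eq_cube power2_eq_square algebra_simps)
  also have "\<dots> \<le> (z ^ 3 / 7) * (4 * z\<^sup>2) + (z\<^sup>2 / 3) * (11 / 10 * z ^ 3)" using 1 2 by linarith
  also have "\<dots> = 197 / 210 * z ^ 5" by (simp add: eval_nat_numeral field_simps)
  also have "\<dots> \<le> z ^ 5" using assms(1) by simp
  finally show ?thesis .
qed

text \<open>Up to 32 the target length rounds up to 1. Beyond that, n^(3/5) = n^(1/10) * sqrt n
  \<le> 3 * sqrt n, so \<open>2 * h - 1\<close> is below 3/4 * sqrt n + 1, which is less than sqrt n
  once sqrt n exceeds 4.\<close>

lemma small_length_square_less:
  fixes n h :: nat
  assumes "2 \<le> n" "n \<le> 32768" "h = nat \<lceil>(1/8) * real n powr (3/5)\<rceil>"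
  shows "0 < h" "(2 * h - 1)\<^sup>2 < n"
proof -
  let ?c = "(1/8) * real n powr (3/5)"
  have c: "0 < ?c" using assms(1) by simp
  then show h0: "0 < h" using assms(3) by simp
  have h: "real h < ?c + 1" using assms(3) c by linarith
  show "(2 * h - 1)\<^sup>2 < n"
  proof (cases "n \<le> 32")
    case True
    have "real n powr (3/5) \<le> 32 powr (3/5)" using True by (intro powr_mono2) auto
    also have "(32::real) powr (3/5) = (2 powr 5) powr (3/5)" by (simp add: powr_numeral)
    also have "\<dots> = 8" unfolding powr_powr by (simp add: powr_numeral)
    finally have "h = 1" using h h0 by linarith
    then show ?thesis using assms(1) by simp
  next
    case False
    \<comment> \<open>32768 = 2^15, so its tenth root is 2 * sqrt 2.\<close>
    have "real n powr (1/10) \<le> 32768 powr (1/10)" using assms(2) by (intro powr_mono2) auto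
    also have "(32768::real) powr (1/10) = (2 powr 15) powr (1/10)" by (simp add: powr_numeral)
    also have "\<dots> = 2 powr 1 * 2 powr (1/2)" unfolding powr_powr powr_add[symmetric] by simp
    also have "\<dots> = 2 * sqrt 2" by (simp add: powr_half_sqrt)
    also have "\<dots> \<le> 3" by (rule power2_le_imp_le) (auto simp: power_mult_distrib)
    finally have tenth: "real n powr (1/10) \<le> 3" .
    have "real n powr (3/5) = real n powr (1/10) * real n powr (1/2)"
      unfolding powr_add[symmetric] by simp
    also have "\<dots> \<le> 3 * sqrt (real n)"
      using tenth by (simp add: powr_half_sqrt mult_right_mono)
    finally have "real h < 3 / 8 * sqrt n + 1" using h by linarith
    moreover have "4 < sqrt n" using False by (intro real_less_rsqrt) auto
    ultimately have "2 * real h - 1 < sqrt n" by linarith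
    then have "real (2 * h - 1) < sqrt n" using h0 by (simp add: of_nat_diff)
    then have "(real (2 * h - 1))\<^sup>2 < (sqrt n)\<^sup>2" by (intro power_strict_mono) auto
    then have "real ((2 * h - 1)\<^sup>2) < real n" by simp
    then show ?thesis by linarith
  qed
qed

text \<open>With z = n^(1/5), the choices are \<open>m + 1\<close> about z / 2, \<open>s\<close>
  about 2 * z^2 and \<open>r\<close> about z^2 / 4. The bound 32768 = 8^5 is what gives
  \<open>8 \<le> z\<close>.\<close>

lemma large_parameters:
  fixes n :: nat
  assumes "32768 \<le> n"
  shows "\<exists>r m s. 0 < s \<and> r * (3 * (m ^ 3 + 1) + 2 * (n div s + 1) + Suc m * s) \<le> n \<and>
    (1/8) * real n powr (3/5) \<le> real (r * Suc m)"
proof -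
  define z where "z = real n powr (1/5)"
  have n: "z ^ 5 = real n" using assms by (simp add: z_def powr_power)
  have z3: "z ^ 3 = real n powr (3/5)" using assms by (simp add: z_def powr_power)
  have z: "8 \<le> z"
  proof (rule ccontr)
    assume "\<not> 8 \<le> z"
    then have "z ^ 5 < 8 ^ 5" by (intro power_strict_mono) (auto simp: z_def)
    then show False using assms n by simp
  qed
  define x where "x = nat \<lceil>z / 2\<rceil>"
  define s where "s = nat \<lceil>2 * z\<^sup>2\<rceil>"
  \<comment> \<open>Just enough rounds for \<open>r * x\<close> to reach z^3 / 8, the required
    length.\<close>
  define r where "r = nat \<lceil>z ^ 3 / (8 * x)\<rceil>"
  define m where "m = x - 1"
  have x: "z / 2 \<le> x" "x \<le> z / 2 + 1" using z unfolding x_def by linarith+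
  have m: "x = Suc m" using x z unfolding m_def by linarith
  have s: "2 * z\<^sup>2 \<le> s" "s \<le> 2 * z\<^sup>2 + 1" using zero_le_power2[of z] unfolding s_def by linarith+
  have "0 \<le> z ^ 3 / (8 * x)" using z by simp
  then have r: "z ^ 3 / (8 * x) \<le> r" "r \<le> z ^ 3 / (8 * x) + 1" unfolding r_def by linarith+
  have "0 < z\<^sup>2" using z by simp
  then have "0 < s" using s by linarith
  have "real (n div s) \<le> n / s" by (rule of_nat_div_le_of_nat)
  also have "\<dots> \<le> n / (2 * z\<^sup>2)" using s z \<open>0 < s\<close> by (intro divide_left_mono mult_pos_pos) auto
  also have "\<dots> = z ^ 3 / 2" unfolding n[symmetric] using z by (simp add: field_simps eval_nat_numeral)
  finally have "real (n div s + 1) \<le> z ^ 3 / 2 + 1" by simp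
  then have "r * (3 * real x ^ 3 + 2 * real (n div s + 1) + x * real s) \<le> z ^ 5"
    using x s r z by (intro rounds_cost_le) auto
  then have "real (r * (3 * x ^ 3 + 2 * (n div s + 1) + x * s)) \<le> real n"
    unfolding n of_nat_mult of_nat_add of_nat_power by simp
  then have "r * (3 * x ^ 3 + 2 * (n div s + 1) + x * s) \<le> n" by linarith
  \<comment> \<open>Passes from the estimate in \<open>x = Suc m\<close> to the actual number of
    triples per round.\<close>
  moreover have "m ^ 3 + 1 \<le> x ^ 3"
    unfolding m using power_strict_mono[of m "Suc m" 3] by simp
  ultimately have "r * (3 * (m ^ 3 + 1) + 2 * (n div s + 1) + Suc m * s) \<le> n"
    unfolding m[symmetric] by (meson add_le_mono1 mult_le_mono2 order_trans)
  moreover have "(1/8) * real n powr (3/5) \<le> real (r * Suc m)"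
    using r(1) unfolding m[symmetric] z3[symmetric] by (simp add: m field_simps)
  ultimately show ?thesis using \<open>0 < s\<close> by blast
qed

section \<open>Combination of the small and the large case\<close>

theorem theorem1:
  fixes n :: nat and a :: "nat list"
  assumes "n \<ge> 2" and "is_perm_of a {1..n}"
  shows "\<exists>s t. twins a s t \<and> real (length s) \<ge> (1/8) * real n powr (3/5)"
proof -
  have a: "distinct a" "set a = {1..n}" using assms(2) by (auto simp: is_perm_of_def)
  have len: "length a = n" using distinct_card[OF a(1)] a(2) by simp
  have inj: "inj_on ((!) a) {..<n}" using a(1) len by (auto intro: inj_on_nth)
  have "\<exists>P\<subseteq>{..<n} \<times> {..<n}. twin_pairs ((!) a) P \<and> (1/8) * real n powr (3/5) \<le> real (card P)"
  proof (cases "n \<le> 32768")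
    case True
    define h where "h = nat \<lceil>(1/8) * real n powr (3/5)\<rceil>"
    have "(1/8) * real n powr (3/5) \<le> real h" unfolding h_def by (rule real_nat_ceiling_ge)
    then show ?thesis
      using twin_pairs_of_monotone_subset[OF _ inj, of h] small_length_square_less[OF assms(1) True h_def]
      by auto
  next
    case False
    then obtain r m s where rms: "0 < s"
      "r * (3 * (m ^ 3 + 1) + 2 * (n div s + 1) + Suc m * s) \<le> n"
      "(1/8) * real n powr (3/5) \<le> real (r * Suc m)"
      using large_parameters[of n] by auto
    have "a ! i \<le> n" if "i < n" for i
      using nth_mem[of i a] that len a(2) by auto
    \<comment> \<open>Values go up to \<open>n\<close> itself, so column indices run from 0 to
      \<open>n div s\<close>, which accounts for the extra 1 in the number of columns.\<close>
    then have "(\<lambda>i. a ! i div s) ` {..<n} \<subseteq> {..n div s}" by (auto intro: div_le_mono)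
    then have "card ((\<lambda>i. a ! i div s) ` {..<n}) \<le> n div s + 1"
      using card_mono[of "{..n div s}"] by fastforce
    then obtain P where "P \<subseteq> {..<n} \<times> {..<n}" "twin_pairs ((!) a) P" "card P = r * Suc m"
      using twin_pairs_iterate[where v = "(!) a", OF rms(1) finite_lessThan inj, of "n div s + 1" r m]
        rms(2) by auto
    then show ?thesis using rms(3) by metis
  qed
  then obtain P where P: "P \<subseteq> {..<n} \<times> {..<n}" "twin_pairs ((!) a) P"
    "(1/8) * real n powr (3/5) \<le> real (card P)" by blast
  have "P \<subseteq> {..<length a} \<times> {..<length a}" using P(1) len by simp
  from twins_of_twin_pairs[OF P(2) this a(1)]
  obtain s t where "twins a s t" "length s = card P" by blast
  with P(3) have "twins a s t \<and> (1/8) * real n powr (3/5) \<le> real (length s)" by simp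
  then show ?thesis by blast
qed

end
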